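(* Let $w = (w_n)_{n \geq 0}$ be a complementation-symmetric sequence with complexity $\mathrm{fac}_w(k) = 2k$ for all $k \geq 1$. Then its palindrome complexity satisfies $\mathrm{pal}_w(k) = 2$ for all $k \geq 1$.
   Context: For an infinite sequence $w = w_0 w_1 w_2 \ldots$ on a finite alphabet, a factor of $w$ is a finite word occurring in $w$ as a block of consecutive letters. $\mathrm{fac}_w(k)$ denotes the number of distinct words of length $k$ that are factors of $w$. A palindrome is a word equal to its reversal, and $\mathrm{pal}_w(k)$ denotes the number of distinct palindromes of length $k$ that are factors of $w$. A complementation-symmetric sequence is a sequence on a two-letter alphabet $\{a,b\}$ such that for every factor, the word obtained from it by changing the $a$'s into $b$'s and the $b$'s into $a$'s is also a factor of the sequence. *)

theory Defs
  imports "HOL-Library.Omega_Words_Fun" "HOL-Combinatorics.Transposition"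
begin

definition factors :: "'a word \<Rightarrow> 'a list set" where
  "factors w = {w [i \<rightarrow> j] | i j. i \<le> j}"

definition fac :: "'a word \<Rightarrow> nat \<Rightarrow> nat" where
  "fac w k = card {u \<in> factors w. length u = k}"

definition palindrome :: "'a list \<Rightarrow> bool" where
  "palindrome u \<longleftrightarrow> rev u = u"

definition pal :: "'a word \<Rightarrow> nat \<Rightarrow> nat" where
  "pal w k = card {u \<in> factors w. length u = k \<and> palindrome u}"

text \<open>On words over the alphabet \<open>{a, b}\<close>, the letterwise application of
  \<open>transpose a b\<close> exchanges the letters \<open>a\<close> and \<open>b\<close>.\<close>

definition complementation_symmetric :: "'a \<Rightarrow> 'a \<Rightarrow> 'a word \<Rightarrow> bool" where
  "complementation_symmetric a b w \<longleftrightarrow>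
     a \<noteq> b \<and> range w \<subseteq> {a, b} \<and>
     (\<forall>u \<in> factors w. map (transpose a b) u \<in> factors w)"

end

theory Submission
  imports Defs
begin

text \<open>
  A complementation-symmetric word \<open>w\<close> is determined, up to exchanging its two letters, by the
  binary word \<open>v\<close> that marks the positions where consecutive letters of \<open>w\<close> differ. A factor of
  \<open>v\<close> of length \<open>n\<close> comes from exactly two factors of \<open>w\<close> of length \<open>n + 1\<close>, which are
  complements of each other (lemma \<open>two_fac_changes\<close>). Hence \<open>w\<close> has complexity \<open>2 k\<close> if and only
  if \<open>v\<close> has complexity \<open>n + 1\<close>, that is, if \<open>v\<close> is Sturmian.

  In a Sturmian word every palindromic factor \<open>u\<close> has exactly one palindromic extension
  \<open>c u c\<close> (lemmas \<open>palindrome_extension_exists\<close> and \<open>palindrome_extension_unique\<close>). A palindrome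
  \<open>t\<close> of \<open>w\<close> has as its sequence of changes a palindrome of \<open>v\<close>, and extending \<open>t\<close> by a
  letter \<open>c\<close> on both sides extends the changes on both sides by the truth value of
  \<open>c \<noteq> hd t\<close>. So unique palindromic extension passes from \<open>v\<close> to the nonempty palindromes of
  \<open>w\<close>, and \<open>pal w (n + 2) = pal w n\<close> for \<open>n \<ge> 1\<close>. There are two palindromes of length 1, the
  letters, and two of length 2, which are the two lifts of a single non-change.

  The Sturmian facts rest on special factors. Complexity \<open>n + 1\<close> forces exactly one right
  special factor in each length. As long as no right special factor is met, the next letter
  is determined by the preceding ones; since the word is not eventually periodic, the right
  special factor of length \<open>n\<close> therefore starts at some of any \<open>n + 1\<close> consecutive positions.
  If \<open>u\<close> were a palindrome with two palindromic extensions, one of its extensions to the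
  left, \<open>e u\<close>, would be right special and would have to reappear so soon after the start of
  \<open>f u f\<close>, with \<open>f\<close> the other letter, that the two copies of \<open>u\<close> overlap or touch, and
  the symmetry of \<open>u\<close> gives a contradiction. This also yields closure under reversal
  (lemma \<open>rev_factor\<close>), from which the existence of a palindromic extension follows.
\<close>

section \<open>Factors of infinite words\<close>

lemma factor_iff: "u \<in> factors x \<longleftrightarrow> (\<exists>i n. u = map x [i..<i + n])"
proof
  assume "u \<in> factors x"
  then obtain i j where "u = map x [i..<j]" "i \<le> j"
    by (auto simp: factors_def subsequence_def)
  then show "\<exists>i n. u = map x [i..<i + n]"
    by (metis le_add_diff_inverse)
next
  assume "\<exists>i n. u = map x [i..<i + n]"
  then show "u \<in> factors x"
    unfolding factors_def subsequence_def using le_add1 by blast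
qed

lemma factorI: "map x [i..<i + n] \<in> factors x"
  unfolding factor_iff by blast

lemma factorE:
  assumes "u \<in> factors x"
  obtains i n where "u = map x [i..<i + n]" "length u = n"
  using assms unfolding factor_iff by fastforce

lemma factors_of_length: "{u \<in> factors x. length u = n} = range (\<lambda>i. map x [i..<i + n])"
  by (auto simp: factorI elim: factorE)

lemma map_upt_eq_iff:
  "map f [i..<i + n] = map g [j..<j + n] \<longleftrightarrow> (\<forall>k<n. f (i + k) = g (j + k))"
  by (simp add: list_eq_iff_nth_eq)

lemma factor_nthI:
  assumes "\<And>k. k < length u \<Longrightarrow> u ! k = x (i + k)"
  shows "u \<in> factors x"
proof -
  have "u = map x [i..<i + length u]"
    by (rule nth_equalityI) (use assms in auto)
  then show ?thesis
    unfolding factor_iff by blast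
qed

lemma factor_prefix:
  assumes "u @ s \<in> factors x"
  shows "u \<in> factors x"
proof -
  obtain i n where *: "u @ s = map x [i..<i + n]" "length (u @ s) = n"
    using assms by (rule factorE)
  have "u ! k = x (i + k)" if "k < length u" for k
  proof -
    have "k < n"
      using *(2) that by simp
    then show ?thesis
      using nth_append_left[OF that, of s] unfolding *(1) by simp
  qed
  then show ?thesis
    by (rule factor_nthI)
qed

lemma factor_suffix:
  assumes "p @ u \<in> factors x"
  shows "u \<in> factors x"
proof -
  obtain i n where *: "p @ u = map x [i..<i + n]" "length (p @ u) = n"
    using assms by (rule factorE)
  have "u ! k = x (i + length p + k)" if "k < length u" for k
  proof -
    have "length p + k < n"
      using *(2) that by simp
    then show ?thesis
      using nth_append_length_plus[of p u k] unfolding *(1) by (simp add: add.assoc)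
  qed
  then show ?thesis
    by (rule factor_nthI)
qed

lemma factor_tl: "c # u \<in> factors x \<Longrightarrow> u \<in> factors x"
  using factor_suffix[of "[c]" u x] by simp

lemma factor_snoc:
  assumes "u \<in> factors x"
  obtains c where "u @ [c] \<in> factors x"
proof -
  obtain i n where "u = map x [i..<i + n]" "length u = n"
    using assms by (rule factorE)
  then have "u @ [x (i + n)] \<in> factors x"
    using factorI[of x i "Suc n"] by simp
  then show thesis
    by (rule that)
qed

lemma factor_suffix_word:
  assumes "u \<in> factors (suffix N x)"
  obtains i n where "N \<le> i" "u = map x [i..<i + n]"
proof -
  obtain i n where "u = map (suffix N x) [i..<i + n]" "length u = n"
    using assms by (rule factorE)
  then have "u = map x [N + i..<N + i + n]"
    unfolding map_upt_eq_iff by (simp add: list_eq_iff_nth_eq add.assoc)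
  with le_add1 show thesis
    by (rule that)
qed

lemma factors_suffix_subset: "factors (suffix N x) \<subseteq> factors x"
  by (auto simp: factorI elim: factor_suffix_word)

lemma finite_factors_of_length: "finite {u \<in> factors (x :: bool word). length u = n}"
  by (rule finite_subset[OF _ finite_lists_length_eq[of UNIV n]]) auto

lemma fac_0: "fac x 0 = 1"
proof -
  have "{u \<in> factors x. length u = 0} = {[]}"
    using factorI[of x 0 0] by auto
  then show ?thesis
    by (simp add: fac_def)
qed

section \<open>Right special factors and periodicity\<close>

definition right_special :: "bool word \<Rightarrow> bool list \<Rightarrow> bool" where
  "right_special x u \<longleftrightarrow> (\<forall>c. u @ [c] \<in> factors x)"

lemma right_special_factor: "right_special x u \<Longrightarrow> u \<in> factors x"
  by (metis right_special_def factor_prefix)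

lemma right_special_tl: "right_special x (c # u) \<Longrightarrow> right_special x u"
  unfolding right_special_def by (metis append_Cons factor_tl)

lemma right_specialI:
  assumes "u @ [c] \<in> factors x" "u @ [d] \<in> factors x" "c \<noteq> d"
  shows "right_special x u"
  unfolding right_special_def
proof
  fix e
  show "u @ [e] \<in> factors x"
    using assms by (cases "e = c") auto
qed

lemma right_extension_unique:
  assumes "\<not> right_special x u" "u @ [c] \<in> factors x" "u @ [d] \<in> factors x"
  shows "c = d"
  using right_specialI assms by blast

text \<open>Between two occurrences of the same window, a stretch without right special windows leaves no
  choice for the next letter, so the word runs through the same cycle forever. The induction has
  to carry along that no later window is right special either, because it equals one of the
  windows of the first cycle.\<close>
lemma periodic_if_window_repeats:
  assumes "p < q" and rep: "map x [p..<p + n] = map x [q..<q + n]"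
    and ns: "\<And>t. p \<le> t \<Longrightarrow> t < q \<Longrightarrow> \<not> right_special x (map x [t..<t + n])"
    and "p + n \<le> k"
  shows "x (k + (q - p)) = x k"
proof -
  define W where "W t = map x [t..<t + n]" for t
  define d where "d = q - p"
  have snoc: "W t @ [x (t + n)] \<in> factors x" for t
    using factorI[of x t "Suc n"] by (simp add: W_def)
  have next_letter: "x (t + d + n) = x (t + n)"
    if "W (t + d) = W t" "\<not> right_special x (W t)" for t
    using right_extension_unique[OF that(2) _ snoc[of t]] snoc[of "t + d"] that(1) by metis
  have main: "W (t + d) = W t \<and> \<not> right_special x (W t)" if "p \<le> t" for t
    using that
  proof (induction t rule: less_induct)
    case (less t)
    have eq: "W (t + d) = W t"
    proof (cases "t = p")
      case True
      then show ?thesis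
        using rep \<open>p < q\<close> by (simp add: W_def d_def)
    next
      case False
      define s where "s = t - 1"
      have t: "t = Suc s" "p \<le> s"
        using False less.prems by (auto simp: s_def)
      have IH: "W (s + d) = W s" "\<not> right_special x (W s)"
        using less.IH[of s] t by auto
      have "x (s + d + k) = x (s + k)" if "k \<le> n" for k
        using IH(1) next_letter[OF IH] that
        by (cases "k = n") (auto simp: W_def map_upt_eq_iff)
      then have "x (Suc s + d + k) = x (Suc s + k)" if "k < n" for k
        using that by (metis Suc_leI add_Suc add_Suc_right)
      then show ?thesis
        unfolding W_def map_upt_eq_iff t by blast
    qed
    moreover have "\<not> right_special x (W t)"
    proof (cases "t < q")
      case True
      then show ?thesis
        using ns less.prems by (simp add: W_def)
    next
      case False
      then have "t - d < t" "p \<le> t - d" "t - d + d = t"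
        using \<open>p < q\<close> by (auto simp: d_def)
      then show ?thesis
        using less.IH[of "t - d"] by metis
    qed
    ultimately show ?case
      by simp
  qed
  have "x (k - n + d + n) = x (k - n + n)"
    using main[of "k - n"] next_letter[of "k - n"] \<open>p + n \<le> k\<close> by auto
  then show ?thesis
    using \<open>p + n \<le> k\<close> by (simp add: d_def add.commute add.left_commute)
qed

lemma fac_le_if_eventually_periodic:
  fixes x :: "'a word"
  assumes per: "\<And>k. N \<le> k \<Longrightarrow> x (k + d) = x k" and "d > 0"
  shows "fac x n \<le> N + d"
proof -
  have "map x [i..<i + n] \<in> (\<lambda>i. map x [i..<i + n]) ` {..<N + d}" for i
  proof (induction i rule: less_induct)
    case (less i)
    show ?case
    proof (cases "i < N + d")
      case False
      then have "x (i - d + k) = x (i + k)" for k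
        using per[of "i - d + k"] by (simp add: add.commute add.left_commute)
      then have "map x [i - d..<i - d + n] = map x [i..<i + n]"
        unfolding map_upt_eq_iff by blast
      then show ?thesis
        using less[of "i - d"] False \<open>d > 0\<close> by simp
    qed simp
  qed
  then have "{u \<in> factors x. length u = n} \<subseteq> (\<lambda>i. map x [i..<i + n]) ` {..<N + d}"
    by (auto simp: factors_of_length)
  then have "fac x n \<le> card ((\<lambda>i. map x [i..<i + n]) ` {..<N + d})"
    unfolding fac_def by (intro card_mono) auto
  also have "\<dots> \<le> N + d"
    using card_image_le[of "{..<N + d}"] by simp
  finally show ?thesis .
qed

text \<open>Deleting the last letter maps the factors of length \<open>n + 1\<close> onto those of length \<open>n\<close>, and a
  right special factor has two preimages. The map stays surjective when one of the two is removed
  for every element of \<open>S\<close>.\<close>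
lemma fac_Suc_ge:
  fixes x :: "bool word"
  assumes S: "\<And>u. u \<in> S \<Longrightarrow> right_special x u \<and> length u = n" and "finite S"
  shows "fac x n + card S \<le> fac x (Suc n)"
proof -
  let ?F = "\<lambda>n. {u \<in> factors x. length u = n}"
  let ?S = "(\<lambda>u. u @ [True]) ` S"
  have sub: "?S \<subseteq> ?F (Suc n)"
    using S by (auto simp: right_special_def)
  have "?F n \<subseteq> butlast ` (?F (Suc n) - ?S)"
  proof
    fix u assume u: "u \<in> ?F n"
    have "\<exists>c. u @ [c] \<in> factors x \<and> u @ [c] \<notin> ?S"
    proof (cases "u \<in> S")
      case True
      then have "u @ [False] \<in> factors x"
        using S by (simp add: right_special_def)
      then show ?thesis
        by blast
    next
      case False
      then show ?thesis
        using u by (auto elim: factor_snoc)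
    qed
    then obtain c where "u @ [c] \<in> ?F (Suc n) - ?S"
      using u by auto
    then show "u \<in> butlast ` (?F (Suc n) - ?S)"
      by (rule rev_image_eqI) simp
  qed
  then have "card (?F n) \<le> card (?F (Suc n) - ?S)"
    by (rule surj_card_le[rotated]) (intro finite_Diff finite_factors_of_length)
  also have "\<dots> = card (?F (Suc n)) - card S"
    using sub \<open>finite S\<close> by (simp add: card_Diff_subset card_image inj_on_def)
  finally have "fac x n \<le> fac x (Suc n) - card S"
    by (simp add: fac_def)
  moreover have "card S \<le> fac x (Suc n)"
    using card_mono[OF finite_factors_of_length sub] by (simp add: fac_def card_image inj_on_def)
  ultimately show ?thesis
    by linarith
qed

section \<open>Sturmian words\<close>

definition sturmian :: "bool word \<Rightarrow> bool" where
  "sturmian x \<longleftrightarrow> (\<forall>n. fac x n = Suc n)"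

lemma sturmian_not_eventually_periodic:
  assumes "sturmian x" "d > 0" "\<And>k. N \<le> k \<Longrightarrow> x (k + d) = x k"
  shows False
proof -
  have "fac x (N + d) \<le> N + d"
    using assms(2,3) by (intro fac_le_if_eventually_periodic)
  then show False
    using \<open>sturmian x\<close> by (simp add: sturmian_def)
qed

text \<open>This is the argument of Morse and Hedlund: without right special factors of length \<open>n\<close> the
  first repetition of a window would start a period. It is needed for all tails of the word, since
  recurrence is derived from it.\<close>
lemma right_special_exists_suffix:
  assumes "sturmian x"
  obtains u where "right_special (suffix N x) u" "length u = n"
proof (rule ccontr)
  note hit = that
  assume no: "\<not> thesis"
  have ns: "\<not> right_special (suffix N x) u" if "length u = n" for u
    using no hit that by blast
  let ?y = "suffix N x"
  let ?W = "\<lambda>i. map ?y [i..<i + n]"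
  have "finite (range ?W)"
    using finite_factors_of_length[of ?y n] by (simp only: factors_of_length)
  then have "\<not> inj ?W"
    using finite_imageD infinite_UNIV_nat by blast
  then obtain p q where pq: "p < q" "?W p = ?W q"
    by (meson linorder_inj_onI')
  have per: "?y (k + (q - p)) = ?y k" if "p + n \<le> k" for k
    using periodic_if_window_repeats[of p q ?y n k] pq ns that by simp
  then have "x (k + (q - p)) = x k" if "N + p + n \<le> k" for k
  proof -
    have "x (N + (k - N) + (q - p)) = x (N + (k - N))"
      using per[of "k - N"] that by (simp add: add.assoc)
    then show ?thesis
      using that by simp
  qed
  then show False
    using sturmian_not_eventually_periodic[OF assms, of "q - p" "N + p + n"] pq(1) by simp
qed

lemma right_special_exists:
  assumes "sturmian x"
  obtains u where "right_special x u" "length u = n"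
  using right_special_exists_suffix[OF assms, of 0 n] by auto

text \<open>Two right special factors of the same length would make the complexity jump by 2.\<close>
lemma right_special_unique:
  assumes "sturmian x" "right_special x u" "right_special x v" "length u = length v"
  shows "u = v"
proof (rule ccontr)
  assume "u \<noteq> v"
  have "fac x (length v) + card {u, v} \<le> fac x (Suc (length v))"
    using assms by (intro fac_Suc_ge) auto
  then show False
    using \<open>u \<noteq> v\<close> \<open>sturmian x\<close> by (simp add: sturmian_def)
qed

lemma right_special_extend_left:
  assumes "sturmian x" "right_special x u"
  obtains c where "right_special x (c # u)"
proof -
  obtain r where r: "right_special x r" "length r = Suc (length u)"
    using right_special_exists[OF assms(1)] .
  then obtain c s where s: "r = c # s" "length s = length u"
    by (auto simp: length_Suc_conv)
  then have "right_special x s"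
    using r(1) right_special_tl by simp
  then have "s = u"
    using right_special_unique[OF assms(1) _ assms(2)] s(2) by simp
  then show thesis
    using that[of c] r(1) s(1) by simp
qed

text \<open>A tail also has a right special factor in each length, so its complexity is at least
  \<open>n + 1\<close>; its factors are among those of the whole word, of which there are no more. Recurrence
  is what makes factors extendable to the left.\<close>
lemma sturmian_recurrent:
  assumes "sturmian x"
  shows "factors (suffix N x) = factors x"
proof -
  let ?F = "\<lambda>x n. {u \<in> factors x. length u = n}"
  have ge: "Suc n \<le> fac (suffix N x) n" for n
  proof (induction n)
    case 0
    show ?case
      by (simp add: fac_0)
  next
    case (Suc n)
    obtain u where "right_special (suffix N x) u" "length u = n"
      using right_special_exists_suffix[OF assms] .
    then have "fac (suffix N x) n + card {u} \<le> fac (suffix N x) (Suc n)"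
      by (intro fac_Suc_ge) auto
    moreover have "card {u} = 1"
      by simp
    ultimately show ?case
      using Suc.IH by linarith
  qed
  have eq: "?F (suffix N x) n = ?F x n" for n
  proof (rule card_seteq)
    show "card (?F x n) \<le> card (?F (suffix N x) n)"
      using ge[of n] assms by (simp add: fac_def sturmian_def)
    show "?F (suffix N x) n \<subseteq> ?F x n"
      using factors_suffix_subset[of N x] by blast
  qed (rule finite_factors_of_length)
  have "u \<in> factors (suffix N x) \<longleftrightarrow> u \<in> factors x" for u
    using eq[of "length u"] by blast
  then show ?thesis
    by blast
qed

lemma factor_Cons:
  assumes "sturmian x" "u \<in> factors x"
  obtains c where "c # u \<in> factors x"
proof -
  have "u \<in> factors (suffix 1 x)"
    using assms sturmian_recurrent by blast
  then obtain i n where i: "1 \<le> i" "u = map x [i..<i + n]"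
    by (rule factor_suffix_word)
  then have "x (i - 1) # u \<in> factors x"
    using factorI[of x "i - 1" "Suc n"] by (simp add: upt_conv_Cons del: upt_Suc)
  then show thesis
    by (rule that)
qed

text \<open>If \<open>r\<close> started at none of the \<open>n + 1\<close> positions from \<open>i\<close> to \<open>i + n\<close>, the windows there would
  take only the \<open>n\<close> remaining values. One of them would be repeated, without a right special window
  in between.\<close>
lemma right_special_gap:
  assumes "sturmian x" "right_special x r" "length r = n"
  obtains m where "m \<le> n" "map x [i + m..<i + m + n] = r"
proof (rule ccontr)
  assume "\<not> thesis"
  note hit = that
  let ?W = "\<lambda>t. map x [t..<t + n]"
  let ?F = "{u \<in> factors x. length u = n}"
  have no_r: "?W t \<noteq> r" if "t \<in> {i..i + n}" for t
  proof -
    have "i + (t - i) = t" "t - i \<le> n"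
      using that by auto
    then show ?thesis
      using \<open>\<not> thesis\<close> hit[of "t - i"] by fastforce
  qed
  then have "?W ` {i..i + n} \<subseteq> ?F - {r}"
    by (simp add: factorI image_subset_iff)
  then have "card (?W ` {i..i + n}) \<le> card (?F - {r})"
    by (intro card_mono finite_Diff finite_factors_of_length)
  also have "\<dots> = n"
    using assms right_special_factor[of x r] finite_factors_of_length[of x n]
    by (simp add: sturmian_def fac_def)
  finally have "\<not> inj_on ?W {i..i + n}"
    by (auto dest!: card_image)
  then obtain p q where "p \<in> {i..i + n}" "q \<in> {i..i + n}" and pq: "p < q" "?W p = ?W q"
    by (meson linorder_inj_onI')
  then have pq': "i \<le> p" "q \<le> i + n"
    by auto
  have "\<not> right_special x (?W t)" if "p \<le> t" "t < q" for t
    using right_special_unique[OF assms(1) _ assms(2), of "?W t"] no_r[of t] that pq' assms(3) by auto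
  then have "x (k + (q - p)) = x k" if "p + n \<le> k" for k
    using periodic_if_window_repeats[of p q x n k] pq that by simp
  then show False
    using sturmian_not_eventually_periodic[OF assms(1), of "q - p" "p + n"] pq(1) by simp
qed

section \<open>Palindromes in Sturmian words\<close>

text \<open>Suppose both palindromic extensions occur. Then \<open>u\<close> is right special, and so is \<open>e u\<close> for some
  letter \<open>e\<close>. Let \<open>f\<close> be the other letter. From the start of an occurrence of \<open>f u f\<close>, the
  factor \<open>e u\<close> must be met after at most \<open>|u| + 1\<close> steps. Its first letter cannot be one
  of the two outer letters \<open>f\<close>. So it falls into the first copy of \<open>u\<close>, and the final \<open>f\<close> of \<open>f u f\<close> into the second copy, at positions
  that the reversal of \<open>u\<close> exchanges; but these letters are \<open>e\<close> and \<open>f\<close>.\<close>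
lemma palindrome_extension_unique:
  assumes "sturmian x" "palindrome u" "c # u @ [c] \<in> factors x" "d # u @ [d] \<in> factors x"
  shows "c = d"
proof (rule ccontr)
  assume "c \<noteq> d"
  have "right_special x u"
    using factor_tl[OF assms(3)] factor_tl[OF assms(4)] \<open>c \<noteq> d\<close> by (rule right_specialI)
  then obtain e where e: "right_special x (e # u)"
    using right_special_extend_left assms(1) by blast
  define f where "f = (\<not> e)"
  define n where "n = Suc (length u)"
  have f: "f # u @ [f] \<in> factors x"
    using assms(3,4) \<open>c \<noteq> d\<close> by (cases "f = c") auto
  then obtain i where "f # u @ [f] = map x [i..<i + Suc n]"
    using factorE[OF f] by (metis length_Cons length_append_singleton n_def)
  then have nth: "x (i + k) = (f # u @ [f]) ! k" if "k \<le> n" for k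
    using that by (simp del: upt_Suc)
  obtain m where m: "m \<le> n" "map x [i + m..<i + m + n] = e # u"
    using right_special_gap[OF assms(1) e, where n = n and i = i] by (metis length_Cons n_def)
  then have nth': "x (i + m + k) = (e # u) ! k" if "k < n" for k
    unfolding m(2)[symmetric] using that by simp
  have "x (i + m) = e"
    using nth'[of 0] by (simp add: n_def)
  have "x (i + n) = f"
    using nth[of n] by (simp add: n_def nth_append)
  have "x i = f"
    using nth[of 0] by simp
  have "m \<noteq> 0" "m \<noteq> n"
    using \<open>x (i + m) = e\<close> \<open>x (i + n) = f\<close> \<open>x i = f\<close> by (cases m; auto simp: f_def)+
  then obtain j where j: "m = Suc j" "j < length u"
    using m(1) by (cases m) (auto simp: n_def)
  \<comment> \<open>Position \<open>i + m\<close> is index \<open>j\<close> in the first copy of \<open>u\<close>, and position \<open>i + n\<close> is the mirror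
    index of \<open>j\<close> in the second.\<close>
  have "u ! j = e"
    using nth[of m] \<open>x (i + m) = e\<close> j m(1) by (simp add: nth_append)
  moreover have "u ! (length u - Suc j) = f"
    using nth'[of "n - m"] \<open>x (i + n) = f\<close> j m(1) by (simp add: n_def nth_Cons')
  moreover have "u ! j = u ! (length u - Suc j)"
    using assms(2) rev_nth[OF j(2)] by (simp add: palindrome_def)
  ultimately show False
    by (simp add: f_def)
qed

text \<open>By induction on the length, the claim for \<open>c v d\<close> uses closure for \<open>v\<close> and for its one-letter
  extensions. If \<open>v\<close> extends in only one way to the left or to the right, so does its reversal on the
  opposite side, and an extension of \<open>d (rev v)\<close> or \<open>(rev v) c\<close>, which exists anyway, must be the
  required word. If \<open>v\<close> is special on both sides, then \<open>v\<close> and its reversal are both right special,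
  hence equal, and the uniqueness of palindromic extensions of \<open>v\<close> settles the case \<open>c \<noteq> d\<close>.\<close>
lemma rev_factor:
  assumes "sturmian x" "u \<in> factors x"
  shows "rev u \<in> factors x"
  using assms(2)
proof (induction "length u" arbitrary: u rule: less_induct)
  case less
  have IH: "rev v \<in> factors x" if "v \<in> factors x" "length v < length u" for v
    using less.hyps that by blast
  show ?case
  proof (cases "length u < 2")
    case True
    then have "rev u = u"
      by (cases u) auto
    then show ?thesis
      using less.prems by simp
  next
    case False
    then obtain c s where "u = c # s" "s \<noteq> []"
      by (cases u) auto
    then obtain v d where u: "u = c # v @ [d]"
      by (cases s rule: rev_cases) auto
    have cv: "c # v \<in> factors x" and vd: "v @ [d] \<in> factors x"
      using less.prems factor_prefix[of "c # v" "[d]" x] factor_tl[of c "v @ [d]" x] by (simp_all add: u)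
    have rcv: "rev v @ [c] \<in> factors x" and rvd: "d # rev v \<in> factors x"
      using IH[OF cv] IH[OF vd] by (simp_all add: u)
    have "d # rev v @ [c] \<in> factors x"
    proof (cases "right_special x v \<and> (\<forall>e. e # v \<in> factors x)")
      case True
      then have "right_special x (rev v)"
        unfolding right_special_def using IH[of "e # v" for e] by (simp add: u)
      then have pal: "rev v = v"
        using right_special_unique[OF assms(1)] True by simp
      show ?thesis
      proof (cases "c = d")
        case True
        then show ?thesis
          using less.prems by (simp add: u pal)
      next
        case False
        obtain e where e: "right_special x (e # v)"
          using right_special_extend_left[OF assms(1)] True by blast
        \<comment> \<open>Either \<open>d v\<close> is right special and has every extension, or \<open>c v\<close> is; then \<open>c v c\<close> occurs
          and rules out \<open>d v d\<close>.\<close>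
        obtain f where f: "d # v @ [f] \<in> factors x"
          using factor_snoc[OF rvd] by (auto simp: pal)
        show ?thesis
        proof (cases "e = d")
          case True
          then show ?thesis
            using e by (simp add: right_special_def pal)
        next
          case False
          then have "e = c"
            using \<open>c \<noteq> d\<close> by auto
          then have "c # v @ [c] \<in> factors x"
            using e by (simp add: right_special_def)
          then have "f \<noteq> d"
            using palindrome_extension_unique[OF assms(1), of v c d] f pal \<open>c \<noteq> d\<close>
            unfolding palindrome_def by blast
          then have "f = c"
            using \<open>c \<noteq> d\<close> by auto
          then show ?thesis
            using f by (simp add: pal)
        qed
      qed
    next
      case False
      then consider "\<not> right_special x v" | e where "e # v \<notin> factors x"
        by blast
      then show ?thesis
      proof cases
        case 1
        obtain e where e: "e # rev v @ [c] \<in> factors x"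
          using factor_Cons[OF assms(1) rcv] .
        then have "v @ [e] \<in> factors x"
          using IH[of "e # rev v"] factor_prefix[of "e # rev v" "[c]" x] by (simp add: u)
        then have "e = d"
          using vd by (rule right_extension_unique[OF 1])
        then show ?thesis
          using e by simp
      next
        case 2
        obtain f where f: "d # rev v @ [f] \<in> factors x"
          using factor_snoc[OF rvd] by auto
        have "f # v \<in> factors x"
          using f IH[of "rev v @ [f]"] factor_tl[of d "rev v @ [f]" x] by (simp add: u)
        have "f = c"
        proof (rule ccontr)
          assume "f \<noteq> c"
          then have "e = f \<or> e = c"
            by auto
          then show False
            using 2 cv \<open>f # v \<in> factors x\<close> by blast
        qed
        then show ?thesis
          using f by simp
      qed
    qed
    then show ?thesis
      by (simp add: u)
  qed
qed

text \<open>Some extension \<open>c u d\<close> occurs. If \<open>c \<noteq> d\<close>, its reversal \<open>d u c\<close> occurs too, so \<open>u\<close> is right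
  special. Then \<open>e u\<close> is right special for some \<open>e\<close>, and one of its extensions is \<open>e u e\<close>.\<close>
lemma palindrome_extension_exists:
  assumes "sturmian x" "palindrome u" "u \<in> factors x"
  obtains c where "c # u @ [c] \<in> factors x"
proof -
  obtain c where c: "c # u \<in> factors x"
    using factor_Cons[OF assms(1,3)] .
  obtain d where cd: "c # u @ [d] \<in> factors x"
    using factor_snoc[OF c] by auto
  show thesis
  proof (cases "c = d")
    case True
    then show ?thesis
      using cd that by simp
  next
    case False
    have dc: "d # u @ [c] \<in> factors x"
      using rev_factor[OF assms(1) cd] assms(2) by (simp add: palindrome_def)
    have "right_special x u"
      using factor_tl[OF dc] factor_tl[OF cd] False by (rule right_specialI)
    then obtain e where "right_special x (e # u)"
      using right_special_extend_left assms(1) by blast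
    then show ?thesis
      using that[of e] by (simp add: right_special_def)
  qed
qed

section \<open>The word of letter changes\<close>

fun changes :: "'a list \<Rightarrow> bool list" where
  "changes (c # d # u) = (c \<noteq> d) # changes (d # u)"
| "changes _ = []"

lemma changes_snoc: "changes (u @ [c, d]) = changes (u @ [c]) @ [c \<noteq> d]"
proof (induction u)
  case (Cons e u)
  then show ?case
    by (cases u) auto
qed simp

lemma changes_map_upt:
  "changes (map w [i..<i + Suc n]) = map (\<lambda>i. w i \<noteq> w (Suc i)) [i..<i + n]"
  by (induction n) (simp_all add: changes_snoc)

lemma length_changes: "length (changes u) = length u - 1"
  by (induction u rule: changes.induct) auto

lemma changes_map_inj: "inj f \<Longrightarrow> changes (map f u) = changes u"
  by (induction u rule: changes.induct) (auto dest: injD)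

lemma changes_rev: "changes (rev u) = rev (changes u)"
  by (induction u rule: changes.induct) (auto simp: changes_snoc)

lemma changes_inj:
  assumes "changes u = changes v" "length u = length v" "u \<noteq> []" "hd u = hd v"
    "set u \<subseteq> {a, b}" "set v \<subseteq> {a, b}"
  shows "u = v"
  using assms
proof (induction u arbitrary: v rule: changes.induct)
  case (1 c d u)
  then obtain e v' where v: "v = c # e # v'"
    by (cases v rule: changes.cases) auto
  with 1 have "d = e"
    by auto
  have "d # u = e # v'"
    using "1.prems" v \<open>d = e\<close> by (intro "1.IH") simp_all
  then show ?case
    using v by simp
next
  case ("2_2" c)
  then show ?case
    by (cases v) auto
qed simp

text \<open>The first letter and the changes determine a word, and complementation preserves the changes.\<close>
lemma changes_eqD:
  assumes "changes u = changes v" "length u = length v"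
    and "set u \<subseteq> {a, b}" "set v \<subseteq> {a, b}"
  shows "u = v \<or> u = map (transpose a b) v"
proof (cases u)
  case (Cons c u')
  then obtain d v' where v: "v = d # v'"
    using assms(2) by (cases v) auto
  show ?thesis
  proof (cases "c = d")
    case True
    then show ?thesis
      using changes_inj[of u v a b] assms Cons v by simp
  next
    case False
    then have "hd u = hd (map (transpose a b) v)"
      using assms(3,4) Cons v by (auto simp: transpose_def)
    moreover have "set (map (transpose a b) v) \<subseteq> {a, b}"
      using assms(4) by (auto simp: transpose_def)
    ultimately show ?thesis
      using changes_inj[of u "map (transpose a b) v" a b] assms Cons
      by (simp add: changes_map_inj)
  qed
qed (use assms in simp)

lemma changes_palindrome_extension:
  assumes "palindrome u" "u \<noteq> []"
  shows "changes (c # u @ [c]) = (c \<noteq> hd u) # changes u @ [c \<noteq> hd u]"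
proof -
  obtain d u' where u: "u = d # u'"
    using assms(2) by (cases u) auto
  have "last u = d"
    using hd_rev[of u] assms(1) by (simp add: u palindrome_def)
  then obtain t where t: "u = t @ [d]"
    using append_butlast_last_id[OF assms(2)] by metis
  have "changes (u @ [c]) = changes u @ [d \<noteq> c]"
    unfolding t by (simp add: changes_snoc)
  then show ?thesis
    by (auto simp: u)
qed

lemma palindrome_Suc_SucE:
  assumes "palindrome u" "length u = Suc (Suc n)"
  obtains c t where "u = c # t @ [c]" "palindrome t" "length t = n"
proof -
  obtain c s where cs: "u = c # s" "length s = Suc n"
    using assms(2) by (cases u) auto
  obtain t d where td: "s = t @ [d]"
    using cs(2) by (cases s rule: rev_cases) auto
  have "hd (rev u) = hd u" "butlast (tl (rev u)) = butlast (tl u)"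
    using assms(1) unfolding palindrome_def by simp_all
  then have "d = c" "rev t = t"
    unfolding cs(1) td by simp_all
  have "u = c # t @ [c]" "palindrome t" "length t = n"
    using cs td \<open>d = c\<close> \<open>rev t = t\<close> by (simp_all add: palindrome_def)
  then show thesis
    by (rule that)
qed

context
  fixes w :: "'a word" and a b :: 'a and v :: "bool word"
  assumes sym: "complementation_symmetric a b w"
  defines "v \<equiv> \<lambda>i. w i \<noteq> w (Suc i)"
begin

lemma letter: "w i \<in> {a, b}"
  using sym by (auto simp: complementation_symmetric_def)

lemma set_factor:
  assumes "u \<in> factors w"
  shows "set u \<subseteq> {a, b}"
proof -
  obtain i n where u: "u = map w [i..<i + n]" "length u = n"
    using assms by (rule factorE)
  show ?thesis
    unfolding u(1) using letter by (simp add: image_subset_iff)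
qed

lemma complement_factor: "u \<in> factors w \<Longrightarrow> map (transpose a b) u \<in> factors w"
  using sym by (simp add: complementation_symmetric_def)

lemma factor_iff_changes_factor:
  assumes "u \<noteq> []"
  shows "u \<in> factors w \<longleftrightarrow> set u \<subseteq> {a, b} \<and> changes u \<in> factors v"
proof safe
  assume "u \<in> factors w"
  obtain i n where u: "u = map w [i..<i + n]" "length u = n"
    using \<open>u \<in> factors w\<close> by (rule factorE)
  then obtain m where "n = Suc m"
    using assms by (cases n) auto
  then have "changes u = map v [i..<i + m]"
    unfolding u(1) v_def by (simp only: changes_map_upt)
  then show "changes u \<in> factors v"
    using factorI by simp
next
  assume u: "set u \<subseteq> {a, b}" and "changes u \<in> factors v"
  from this(2) obtain i n where i: "changes u = map v [i..<i + n]" "length (changes u) = n"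
    by (rule factorE)
  let ?u = "map w [i..<i + length u]"
  have "length u = Suc n"
    using assms i(2) by (cases u) (auto simp: length_changes)
  then have "changes ?u = changes u"
    using i(1) by (simp only: changes_map_upt v_def)
  then have "u = ?u \<or> u = map (transpose a b) ?u"
    using u set_factor[OF factorI] by (intro changes_eqD) simp_all
  then show "u \<in> factors w"
    using factorI complement_factor by metis
qed (use set_factor in auto)

text \<open>A factor of \<open>w\<close> is encoded by its changes and its first letter. By complementation symmetry, both
  first letters occur for each factor of \<open>v\<close>.\<close>
lemma two_fac_changes: "fac w (Suc n) = 2 * fac v n"
proof -
  let ?G = "\<lambda>u. (changes u, hd u = a)"
  let ?F = "{u \<in> factors w. length u = Suc n}"
  let ?V = "{u \<in> factors v. length u = n}"
  have "a \<noteq> b"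
    using sym by (simp add: complementation_symmetric_def)
  have "inj_on ?G ?F"
  proof (rule inj_onI)
    fix u u' assume u: "u \<in> ?F" "u' \<in> ?F" "?G u = ?G u'"
    then have "u \<noteq> []" "u' \<noteq> []"
      by auto
    then have "hd u \<in> {a, b}" "hd u' \<in> {a, b}"
      using u set_factor hd_in_set by blast+
    then have "hd u = hd u'"
      using u(3) by auto
    then show "u = u'"
      using u \<open>u \<noteq> []\<close> set_factor by (intro changes_inj[of u u' a b]) auto
  qed
  moreover have "?G ` ?F = ?V \<times> UNIV"
  proof (intro equalityI subsetI)
    fix z assume "z \<in> ?G ` ?F"
    then obtain u where u: "u \<in> ?F" "z = ?G u"
      by blast
    then have "u \<noteq> []"
      by auto
    then show "z \<in> ?V \<times> UNIV"
      using u factor_iff_changes_factor[of u] by (simp add: length_changes)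
  next
    fix z assume "z \<in> ?V \<times> (UNIV :: bool set)"
    then obtain t B where z: "z = (t, B)" "t \<in> ?V"
      by blast
    then obtain i where t: "t = map v [i..<i + n]"
      unfolding factors_of_length by blast
    let ?u = "map w [i..<i + Suc n]"
    let ?u' = "map (transpose a b) ?u"
    have "?u \<in> factors w"
      by (rule factorI)
    then have u: "?u \<in> ?F" "?u' \<in> ?F"
      using complement_factor[of ?u] by simp_all
    have ch: "changes ?u = t" "changes ?u' = t"
      unfolding changes_map_inj[OF inj_transpose] changes_map_upt t v_def by (rule refl)+
    have hd: "hd ?u = w i" "hd ?u' = transpose a b (w i)"
      by (simp_all add: hd_map del: upt_Suc map_map)
    have "(w i = a) \<noteq> (transpose a b (w i) = a)"
      using \<open>a \<noteq> b\<close> letter[of i] by auto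
    then have "B = (w i = a) \<or> B = (transpose a b (w i) = a)"
      by auto
    then have "z = ?G ?u \<or> z = ?G ?u'"
      unfolding z ch hd prod.inject by simp
    then show "z \<in> ?G ` ?F"
      using u by (elim disjE) (rule image_eqI, assumption+)+
  qed
  ultimately have "card ?F = card (?V \<times> (UNIV :: bool set))"
    using card_image[of ?G ?F] by argo
  then show ?thesis
    by (simp add: fac_def card_cartesian_product)
qed

text \<open>Stripping the outer letters is a bijection on palindromic factors, because the possible outer
  letters \<open>c\<close> of \<open>t\<close> correspond, through the truth value of \<open>c \<noteq> hd t\<close>, to the palindromic
  extensions of the changes of \<open>t\<close>. The core \<open>t\<close> has to be nonempty, since otherwise there is no
  change between it and the outer letters.\<close>
lemma pal_Suc_Suc:
  assumes "sturmian v" "n \<ge> 1"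
  shows "pal w (Suc (Suc n)) = pal w n"
proof -
  let ?P = "\<lambda>n. {u \<in> factors w. length u = n \<and> palindrome u}"
  let ?core = "\<lambda>u. butlast (tl u)"
  have decompose: "\<exists>c t. u = c # t @ [c] \<and> t \<in> ?P n" if u: "u \<in> ?P (Suc (Suc n))" for u
  proof -
    have "palindrome u" "length u = Suc (Suc n)"
      using u by simp_all
    then obtain c t where t: "u = c # t @ [c]" "palindrome t" "length t = n"
      by (rule palindrome_Suc_SucE)
    have "t \<in> factors w"
      using u factor_prefix[of t "[c]" w] factor_tl[of c "t @ [c]" w] by (simp add: t(1))
    then show ?thesis
      using t by auto
  qed
  have ext: "c # t @ [c] \<in> factors w \<longleftrightarrow>
      c \<in> {a, b} \<and> (c \<noteq> hd t) # changes t @ [c \<noteq> hd t] \<in> factors v" if "t \<in> ?P n" for c t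
  proof -
    have "t \<noteq> []" "palindrome t"
      using that \<open>n \<ge> 1\<close> by auto
    then show ?thesis
      using set_factor[of t] that factor_iff_changes_factor[of "c # t @ [c]"]
        changes_palindrome_extension[of t c] by auto
  qed
  have ch: "palindrome (changes t)" "changes t \<in> factors v" "hd t \<in> {a, b}" if "t \<in> ?P n" for t
  proof -
    have "t \<noteq> []"
      using that \<open>n \<ge> 1\<close> by auto
    then show "palindrome (changes t)" "changes t \<in> factors v"
      using that factor_iff_changes_factor[of t] changes_rev[of t] by (auto simp: palindrome_def)
    show "hd t \<in> {a, b}"
      using that set_factor \<open>t \<noteq> []\<close> hd_in_set by blast
  qed
  have "bij_betw ?core (?P (Suc (Suc n))) (?P n)"
    unfolding bij_betw_def
  proof (intro conjI inj_onI equalityI subsetI)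
    fix u u' assume u: "u \<in> ?P (Suc (Suc n))" "u' \<in> ?P (Suc (Suc n))" and "?core u = ?core u'"
    moreover obtain c t where t: "u = c # t @ [c]" "t \<in> ?P n"
      using decompose[OF u(1)] by blast
    moreover obtain d t' where "u' = d # t' @ [d]"
      using decompose[OF u(2)] by blast
    ultimately have u': "u' = d # t @ [d]"
      by simp
    have "c # t @ [c] \<in> factors w" "d # t @ [d] \<in> factors w"
      using u by (simp_all add: t(1) u')
    then have "(c \<noteq> hd t) = (d \<noteq> hd t)" "c \<in> {a, b}" "d \<in> {a, b}"
      using palindrome_extension_unique[OF assms(1) ch(1)[OF t(2)]] ext[OF t(2)] by blast+
    then show "u = u'"
      using ch(3)[OF t(2)] by (auto simp: t(1) u')
  next
    fix t assume "t \<in> ?core ` ?P (Suc (Suc n))"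
    then obtain u where "u \<in> ?P (Suc (Suc n))" "t = ?core u"
      by blast
    then show "t \<in> ?P n"
      using decompose[of u] by auto
  next
    fix t assume t: "t \<in> ?P n"
    obtain e where e: "e # changes t @ [e] \<in> factors v"
      using palindrome_extension_exists[OF assms(1) ch(1,2)[OF t]] .
    have "a \<noteq> b"
      using sym by (simp add: complementation_symmetric_def)
    then obtain c where c: "c \<in> {a, b}" "(c \<noteq> hd t) = e"
      using ch(3)[OF t] by (cases e) auto
    then have "c # t @ [c] \<in> ?P (Suc (Suc n))"
      using e t ext[OF t, of c] by (auto simp: palindrome_def)
    then show "t \<in> ?core ` ?P (Suc (Suc n))"
      by (rule rev_image_eqI) simp
  qed
  then show ?thesis
    unfolding pal_def by (rule bij_betw_same_card)
qed

lemma pal_1_2: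
  assumes "sturmian v"
  shows "pal w 1 = 2" "pal w 2 = 2"
proof -
  have "a \<noteq> b"
    using sym by (simp add: complementation_symmetric_def)
  have "[] \<in> factors v"
    using factorI[of v 0 0] by simp
  then have single: "[a] \<in> factors w" "[b] \<in> factors w"
    by (simp_all add: factor_iff_changes_factor)
  have "{u \<in> factors w. length u = 1 \<and> palindrome u} = {[a], [b]}" (is "?P = _")
  proof (intro equalityI subsetI)
    fix u assume u: "u \<in> ?P"
    then obtain c where "u = [c]"
      by (cases u) auto
    then show "u \<in> {[a], [b]}"
      using u set_factor[of u] by simp
  next
    fix u assume "u \<in> {[a], [b]}"
    then show "u \<in> ?P"
      using single by (elim insertE emptyE) (simp_all add: palindrome_def)
  qed
  then show "pal w 1 = 2"
    using \<open>a \<noteq> b\<close> by (simp add: pal_def)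
  obtain r where "right_special v r" "length r = 0"
    using right_special_exists[OF assms] .
  then have "[False] \<in> factors v"
    by (simp add: right_special_def)
  then have double: "[a, a] \<in> factors w" "[b, b] \<in> factors w"
    by (simp_all add: factor_iff_changes_factor)
  have "{u \<in> factors w. length u = 2 \<and> palindrome u} = {[a, a], [b, b]}" (is "?P = _")
  proof (intro equalityI subsetI)
    fix u assume u: "u \<in> ?P"
    then have "palindrome u" "length u = Suc (Suc 0)"
      by simp_all
    then obtain c t where "u = c # t @ [c]" "length t = 0"
      by (rule palindrome_Suc_SucE)
    then have "u = [c, c]"
      by simp
    then show "u \<in> {[a, a], [b, b]}"
      using u set_factor[of u] by simp
  next
    fix u assume "u \<in> {[a, a], [b, b]}"
    then show "u \<in> ?P"
      using double by (elim insertE emptyE) (simp_all add: palindrome_def)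
  qed
  then show "pal w 2 = 2"
    using \<open>a \<noteq> b\<close> by (simp add: pal_def)
qed

end

theorem theorem8:
  fixes w :: "'a word" and a b :: 'a
  assumes "complementation_symmetric a b w"
    and "\<And>k. k \<ge> 1 \<Longrightarrow> fac w k = 2 * k"
  shows "\<forall>k \<ge> 1. pal w k = 2"
proof (intro allI impI)
  let ?v = "\<lambda>i. w i \<noteq> w (Suc i)"
  have "fac ?v n = Suc n" for n
    using two_fac_changes[OF assms(1), of n] assms(2)[of "Suc n"] by simp
  then have v: "sturmian ?v"
    by (simp add: sturmian_def)
  fix k :: nat
  assume "k \<ge> 1"
  then show "pal w k = 2"
  proof (induction k rule: less_induct)
    case (less k)
    consider "k = 1" | "k = 2" | n where "k = Suc (Suc n)" "n \<ge> 1"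
      using less.prems by (metis One_nat_def Suc_1 Suc_le_eq gr0_conv_Suc not_less_eq_eq not_gr_zero)
    then show ?case
      using pal_1_2[OF assms(1) v] pal_Suc_Suc[OF assms(1) v] less.IH by cases auto
  qed
qed

end
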